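(* There exist a hyperconvex diversity $(X,\delta)$ whose induced metric space $(X,d)$ is bounded and a nonexpansive mapping $T\colon (X,d)\to (X,d)$ without fixed points. That is, the bounded metric space induced by a hyperconvex diversity need not have the fixed point property for nonexpansive mappings.
   Context: For a set $X$, $\langle X\rangle$ denotes the set of finite subsets of $X$. A diversity is a pair $(X,\delta)$ with $\delta\colon\langle X\rangle\to\mathbb{R}$ such that (1) $\delta(A)\ge 0$ for all $A\in\langle X\rangle$, and $\delta(A)=0$ if and only if $|A|\le 1$; (2) for all $A,B,C\in\langle X\rangle$ with $B\ne\emptyset$, $\delta(A\cup C)\le\delta(A\cup B)+\delta(B\cup C)$. The induced metric on $X$ is $d(x,y)=\delta(\{x,y\})$. A diversity $(X,\delta)$ is hyperconvex if for every $r\colon\langle X\rangle\to\mathbb{R}$ with $r(\emptyset)=0$ and $\delta\left(\bigcup_{A\in\mathcal{A}}A\right)\le\sum_{A\in\mathcal{A}}r(A)$ for all finite $\mathcal{A}\subseteq\langle X\rangle$, there is $z\in X$ such that $\delta(\{z\}\cup Y)\le r(Y)$ for all finite $Y\subseteq X$. A mapping $T$ of a metric space $(X,d)$ into itself is nonexpansive if $d(Tx,Ty)\le d(x,y)$ for all $x,y$. A metric space has the fixed point property for nonexpansive mappings if every nonexpansive self-mapping of it has a fixed point. *)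

theory Defs
  imports "HOL-Analysis.Analysis"
begin

text \<open>The set of finite subsets of \<open>X\<close> is \<open>Fpow X\<close>. Only the values of \<open>\<delta>\<close> on \<open>Fpow X\<close> matter.\<close>

locale diversity =
  fixes X :: "'a set" and \<delta> :: "'a set \<Rightarrow> real"
  assumes nonneg: "A \<in> Fpow X \<Longrightarrow> 0 \<le> \<delta> A"
    and eq_0_iff: "A \<in> Fpow X \<Longrightarrow> \<delta> A = 0 \<longleftrightarrow> card A \<le> 1"
    and triangle: "\<lbrakk>A \<in> Fpow X; B \<in> Fpow X; C \<in> Fpow X; B \<noteq> {}\<rbrakk>
                    \<Longrightarrow> \<delta> (A \<union> C) \<le> \<delta> (A \<union> B) + \<delta> (B \<union> C)"

locale hyperconvex_diversity = diversity +
  assumes hyperconvex: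
    "\<lbrakk>r {} = 0; \<And>\<A>. \<lbrakk>finite \<A>; \<A> \<subseteq> Fpow X\<rbrakk> \<Longrightarrow> \<delta> (\<Union>\<A>) \<le> (\<Sum>A\<in>\<A>. r A)\<rbrakk>
      \<Longrightarrow> \<exists>z\<in>X. \<forall>Y\<in>Fpow X. \<delta> ({z} \<union> Y) \<le> r Y"

text \<open>The value 0 off \<open>X\<close> is a convention: \<^locale>\<open>Metric_space\<close> asks for a
  distance that is nonnegative and symmetric on the whole type.\<close>

definition induced_metric :: "'a set \<Rightarrow> ('a set \<Rightarrow> real) \<Rightarrow> 'a \<Rightarrow> 'a \<Rightarrow> real" where
  "induced_metric X \<delta> x y = (if x \<in> X \<and> y \<in> X then \<delta> {x, y} else 0)"

lemma (in diversity) Metric_space_induced_metric: "Metric_space X (induced_metric X \<delta>)"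
proof
  show "0 \<le> induced_metric X \<delta> x y" for x y
    using nonneg[of "{x, y}"] by (simp add: induced_metric_def Fpow_def)
  show "induced_metric X \<delta> x y = induced_metric X \<delta> y x" for x y
    by (simp add: induced_metric_def insert_commute conj_commute)
  show "induced_metric X \<delta> x y = 0 \<longleftrightarrow> x = y" if "x \<in> X" "y \<in> X" for x y
    using that eq_0_iff[of "{x, y}"]
    by (cases "x = y") (auto simp: induced_metric_def Fpow_def)
  show "induced_metric X \<delta> x z \<le> induced_metric X \<delta> x y + induced_metric X \<delta> y z"
    if "x \<in> X" "y \<in> X" "z \<in> X" for x y z
    using that triangle[of "{x}" "{y}" "{z}"]
    by (simp add: induced_metric_def Fpow_def insert_commute)
qed

definition nonexpansive_selfmap :: "'a set \<Rightarrow> ('a \<Rightarrow> 'a \<Rightarrow> real) \<Rightarrow> ('a \<Rightarrow> 'a) \<Rightarrow> bool" where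
  "nonexpansive_selfmap M d T \<longleftrightarrow>
     T \<in> M \<rightarrow> M \<and> (\<forall>x\<in>M. \<forall>y\<in>M. d (T x) (T y) \<le> d x y)"

definition fixed_point_property :: "'a set \<Rightarrow> ('a \<Rightarrow> 'a \<Rightarrow> real) \<Rightarrow> bool" where
  "fixed_point_property M d \<longleftrightarrow> (\<forall>T. nonexpansive_selfmap M d T \<longrightarrow> (\<exists>x\<in>M. T x = x))"

end

theory Submission
  imports Defs
begin

text \<open>Take the tight span of the diversity \<open>\<delta> A = |A| - 1\<close> on the integers. Its points are the
  functions \<open>f\<close> that are extremal subject to \<open>\<delta> (\<Union>\<A>) \<le> (\<Sum>A\<in>\<A>. f A)\<close>, and the tight span of any
  diversity is hyperconvex (Bryant and Tupper). Since \<open>f {x} \<le> 1\<close>, the induced metric is bounded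
  by 2, although \<open>\<delta>\<close> is unbounded. Translation of the integers acts isometrically on the tight
  span. A fixed point would be translation invariant; but disjoint translates of \<open>A\<close> show that the
  deficits \<open>|A| - f A\<close> of an admissible \<open>f\<close> add up to at most 1, so an invariant \<open>f\<close> is the
  cardinality, which is not extremal.\<close>

section \<open>The tight span of a diversity\<close>

declare empty_in_Fpow [simp]

lemma Un_in_Fpow [simp]: "A \<in> Fpow Y \<Longrightarrow> B \<in> Fpow Y \<Longrightarrow> A \<union> B \<in> Fpow Y"
  by (simp add: Fpow_def)

lemma UN_in_Fpow: "finite I \<Longrightarrow> (\<And>i. i \<in> I \<Longrightarrow> A i \<in> Fpow Y) \<Longrightarrow> (\<Union>i\<in>I. A i) \<in> Fpow Y"
  by (auto simp: Fpow_def)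

context diversity
begin

definition admissible :: "('a set \<Rightarrow> real) \<Rightarrow> bool" where
  "admissible f \<longleftrightarrow> f {} = 0 \<and> (\<forall>A\<in>Fpow X. \<delta> A \<le> f A)
     \<and> (\<forall>A\<in>Fpow X. \<forall>B\<in>Fpow X. f (A \<union> B) \<le> f A + f B) \<and> (\<forall>A. A \<notin> Fpow X \<longrightarrow> f A = 0)"

text \<open>Subadditivity, which extremality would imply, is built into admissibility. In exchange
  extremality only needs to be tested against a single set \<open>B\<close>: it says
  \<open>f A = (SUP B. \<delta> (A \<union> B) - f B)\<close>.\<close>

definition tight_span :: "('a set \<Rightarrow> real) set" where
  "tight_span = {f. admissible f \<and>
     (\<forall>A\<in>Fpow X. \<forall>c. (\<forall>B\<in>Fpow X. \<delta> (A \<union> B) \<le> c + f B) \<longrightarrow> f A \<le> c)}"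

text \<open>A choice is a total function, so the supremum in \<open>span_diversity\<close> ranges
  over the same set for every \<open>F\<close> and values for different \<open>F\<close> are easy to
  compare.\<close>

definition choices :: "('b \<Rightarrow> 'a set) set" where
  "choices = {\<phi>. \<forall>f. \<phi> f \<in> Fpow X}"

text \<open>Bryant and Tupper's diversity on the tight span. Where the supremum is finite it is the
  least \<open>c\<close> such that every union of chosen sets has \<open>\<delta>\<close> at most
  \<open>c\<close> plus the sum of the charges \<open>f (\<phi> f)\<close>.\<close>

definition span_diversity :: "('a set \<Rightarrow> real) set \<Rightarrow> real" where
  "span_diversity F = (SUP \<phi>\<in>choices. \<delta> (\<Union>f\<in>F. \<phi> f) - (\<Sum>f\<in>F. f (\<phi> f)))"

section \<open>Elementary properties of admissible and extremal functions\<close>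

lemma delta_empty [simp]: "\<delta> {} = 0"
  using eq_0_iff[of "{}"] by simp

lemma choicesD: "\<phi> \<in> choices \<Longrightarrow> \<phi> f \<in> Fpow X"
  by (simp add: choices_def)

lemma admissible_empty: "admissible f \<Longrightarrow> f {} = 0"
  by (simp add: admissible_def)

lemma admissible_ge: "admissible f \<Longrightarrow> A \<in> Fpow X \<Longrightarrow> \<delta> A \<le> f A"
  by (simp add: admissible_def)

lemma admissible_Un: "admissible f \<Longrightarrow> A \<in> Fpow X \<Longrightarrow> B \<in> Fpow X \<Longrightarrow> f (A \<union> B) \<le> f A + f B"
  by (simp add: admissible_def)

lemma admissible_eq_0: "admissible f \<Longrightarrow> A \<notin> Fpow X \<Longrightarrow> f A = 0"
  by (simp add: admissible_def)

lemma admissible_nonneg: "admissible f \<Longrightarrow> 0 \<le> f A"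
  by (metis admissible_eq_0 admissible_ge nonneg order.trans order_refl)

lemma delta_Un_le: "admissible f \<Longrightarrow> A \<in> Fpow X \<Longrightarrow> B \<in> Fpow X \<Longrightarrow> \<delta> (A \<union> B) \<le> f A + f B"
  by (meson Un_in_Fpow admissible_Un admissible_ge order.trans)

lemma admissible_UN:
  assumes "admissible f" "finite I" "\<And>i. i \<in> I \<Longrightarrow> A i \<in> Fpow X"
  shows "f (\<Union>i\<in>I. A i) \<le> (\<Sum>i\<in>I. f (A i))"
  using assms(2,3)
proof (induction I)
  case empty
  then show ?case using admissible_empty[OF assms(1)] by simp
next
  case (insert i I)
  have "f (A i \<union> (\<Union>i\<in>I. A i)) \<le> f (A i) + f (\<Union>i\<in>I. A i)"
    using insert assms(1) by (intro admissible_Un UN_in_Fpow) auto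
  with insert show ?case by simp
qed

lemma tight_span_admissible: "f \<in> tight_span \<Longrightarrow> admissible f"
  by (simp add: tight_span_def)

lemma tight_span_le:
  assumes "f \<in> tight_span" "A \<in> Fpow X" "\<And>B. B \<in> Fpow X \<Longrightarrow> \<delta> (A \<union> B) \<le> c + f B"
  shows "f A \<le> c"
  using assms by (auto simp: tight_span_def)

text \<open>The hypothesis makes \<open>g A\<close> a valid constant in the extremality test of
  \<open>f\<close> at \<open>A\<close>, and vice versa. This is what separates points of the tight
  span.\<close>

lemma tight_span_eqI:
  assumes "f \<in> tight_span" "g \<in> tight_span"
    and le: "\<And>A B. A \<in> Fpow X \<Longrightarrow> B \<in> Fpow X \<Longrightarrow> \<delta> (A \<union> B) \<le> f A + g B"
  shows "f = g"
proof
  fix A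
  show "f A = g A"
  proof (cases "A \<in> Fpow X")
    case True
    have "f A \<le> g A"
      using le[OF _ True] by (intro tight_span_le[OF assms(1) True]) (simp add: Un_commute add.commute)
    moreover have "g A \<le> f A"
      using le[OF True] by (intro tight_span_le[OF assms(2) True])
    ultimately show ?thesis by simp
  next
    case False
    then show ?thesis using assms(1,2) by (simp add: tight_span_admissible admissible_eq_0)
  qed
qed

section \<open>Existence of extremal functions\<close>

text \<open>If \<open>c\<close> passes the extremality test at \<open>A\<close>, forcing the value
  at \<open>A\<close> down to at most \<open>c\<close> and closing up under subadditivity leaves an
  admissible function below \<open>f\<close>. Minimality says that it equals \<open>f\<close>, so
  \<open>f A \<le> c\<close>.\<close>

lemma minimal_admissible_in_tight_span:
  assumes adm: "admissible f"
    and minimal: "\<And>g. admissible g \<Longrightarrow> g \<le> f \<Longrightarrow> g = f"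
  shows "f \<in> tight_span"
proof -
  have "f A \<le> c" if A: "A \<in> Fpow X" and c: "\<And>B. B \<in> Fpow X \<Longrightarrow> \<delta> (A \<union> B) \<le> c + f B" for A c
  proof (cases "A = {}")
    case True
    then show ?thesis using c[of "{}"] admissible_empty[OF adm] by simp
  next
    case False
    have "0 \<le> \<delta> A" using A by (rule nonneg)
    then have c0: "0 \<le> c" using c[of "{}"] admissible_empty[OF adm] by simp
    \<comment> \<open>The largest subadditive function below \<open>f\<close> with value at most \<open>c\<close> at \<open>A\<close>.\<close>
    define V where "V D = {f D} \<union> (\<lambda>C. c + f C) ` {C \<in> Fpow X. A \<union> C = D}" for D
    define g where "g D = (if D \<in> Fpow X then Inf (V D) else 0)" for D
    have V0: "0 \<le> v" if "v \<in> V D" for v D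
      using that c0 admissible_nonneg[OF adm] by (auto simp: V_def)
    have bdd: "bdd_below (V D)" for D
      using V0 by (rule bdd_belowI)
    have g_le: "g D \<le> v" if "D \<in> Fpow X" "v \<in> V D" for v D
      using that bdd by (simp add: g_def cInf_lower)
    have le_g: "b \<le> g D" if "D \<in> Fpow X" "\<And>v. v \<in> V D \<Longrightarrow> b \<le> v" for b D
      using that by (auto simp: g_def V_def intro!: cInf_greatest)
    have V_Un: "\<exists>w\<in>V (D \<union> E). w \<le> u + v" if DE: "D \<in> Fpow X" "E \<in> Fpow X" "u \<in> V D" "v \<in> V E" for D E u v
    proof -
      consider "u = f D" "v = f E"
        | C where "u = f D" "C \<in> Fpow X" "E = A \<union> C" "v = c + f C"
        | C where "v = f E" "C \<in> Fpow X" "D = A \<union> C" "u = c + f C"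
        | C C' where "C \<in> Fpow X" "D = A \<union> C" "u = c + f C" "C' \<in> Fpow X" "E = A \<union> C'" "v = c + f C'"
        using DE(3,4) by (auto simp: V_def)
      then show ?thesis
      proof cases
        case 1
        then show ?thesis using admissible_Un[OF adm DE(1,2)] by (auto simp: V_def)
      next
        case 2
        then have "c + f (D \<union> C) \<in> V (D \<union> E)" using DE by (auto simp: V_def)
        then show ?thesis using admissible_Un[OF adm DE(1) 2(2)] 2 by (intro bexI) auto
      next
        case 3
        then have "c + f (E \<union> C) \<in> V (D \<union> E)" using DE by (auto simp: V_def)
        then show ?thesis using admissible_Un[OF adm DE(2) 3(2)] 3 by (intro bexI) auto
      next
        case 4
        \<comment> \<open>Union is idempotent, so a single copy of \<open>A\<close> covers both
          pieces, and \<open>0 \<le> c\<close> makes dropping the second charge harmless. This is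
          why \<open>V\<close> only offers candidates with at most one copy of
          \<open>A\<close>.\<close>
        then have "c + f (C \<union> C') \<in> V (D \<union> E)" by (auto simp: V_def)
        then show ?thesis using admissible_Un[OF adm 4(1,4)] 4 c0 by (intro bexI) auto
      qed
    qed
    have "admissible g"
      unfolding admissible_def
    proof (intro conjI ballI allI impI)
      \<comment> \<open>As \<open>A\<close> is nonempty, \<open>A \<union> C\<close> is never empty,
        and \<open>f {}\<close> is the only candidate.\<close>
      have "V {} = {0}" using False admissible_empty[OF adm] by (auto simp: V_def)
      then show "g {} = 0" by (simp add: g_def)
    next
      fix D assume D: "D \<in> Fpow X"
      show "\<delta> D \<le> g D"
      proof (rule le_g[OF D])
        fix v assume "v \<in> V D"
        then show "\<delta> D \<le> v" using c admissible_ge[OF adm D] by (auto simp: V_def)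
      qed
    next
      fix D E assume DE: "D \<in> Fpow X" "E \<in> Fpow X"
      have "g (D \<union> E) - u \<le> v" if uv: "u \<in> V D" "v \<in> V E" for u v
        proof -
        obtain w where "w \<in> V (D \<union> E)" "w \<le> u + v" using V_Un[OF DE uv] by blast
        then show ?thesis using g_le[of "D \<union> E" w] DE by simp
      qed
      then have "g (D \<union> E) - u \<le> g E" if "u \<in> V D" for u
        using that DE by (intro le_g) auto
      then have "g (D \<union> E) - g E \<le> g D"
        using DE by (intro le_g) (auto simp: algebra_simps)
      then show "g (D \<union> E) \<le> g D + g E" by simp
    qed (simp add: g_def)
    moreover have "g D \<le> f D" for D
      using g_le[of D "f D"] admissible_eq_0[OF adm] by (cases "D \<in> Fpow X") (auto simp: V_def g_def)
    ultimately have "g = f" by (intro minimal) (auto simp: le_fun_def)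
    moreover have "g A \<le> c"
      using g_le[OF A, of c] admissible_empty[OF adm] by (force simp: V_def image_iff)
    ultimately show ?thesis by simp
  qed
  then show ?thesis using adm by (auto simp: tight_span_def)
qed

text \<open>Zorn's lemma: the pointwise infimum of a nonempty chain of admissible functions is
  admissible, and a minimal one below \<open>h\<close> is minimal among all admissible
  functions.\<close>

lemma tight_span_below_admissible:
  assumes h: "admissible h"
  obtains f where "f \<in> tight_span" "f \<le> h"
proof -
  let ?S = "{f. admissible f \<and> f \<le> h}"
  \<comment> \<open>The order is reversed, so that a maximal element is a minimal function.\<close>
  let ?P = "\<lambda>f g :: 'a set \<Rightarrow> real. g \<le> f"
  have "\<exists>m\<in>?S. \<forall>f\<in>?S. ?P m f \<longrightarrow> f = m"
  proof (rule predicate_Zorn)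
    show "partial_order_on ?S (relation_of ?P ?S)"
      by (auto simp: partial_order_on_def preorder_on_def refl_on_def trans_def antisym_def relation_of_def)
    fix C assume C: "C \<in> Chains (relation_of ?P ?S)"
    then have adm: "admissible f" and le_h: "f \<le> h" if "f \<in> C" for f
      using that by (auto simp: Chains_def relation_of_def)
    have chain: "f \<le> g \<or> g \<le> f" if "f \<in> C" "g \<in> C" for f g
      using C that by (auto simp: Chains_def relation_of_def)
    show "\<exists>u\<in>?S. \<forall>f\<in>C. u \<le> f"
    proof (cases "C = {}")
      case True
      then show ?thesis using h by auto
    next
      case False
      define u where "u A = (INF f\<in>C. f A)" for A
      have "bdd_below ((\<lambda>f. f A) ` C)" for A
        using adm admissible_nonneg by (intro bdd_belowI[of _ 0]) auto
      then have u_le: "u A \<le> f A" if "f \<in> C" for f A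
        using that by (auto simp: u_def intro: cINF_lower)
      have le_u: "b \<le> u A" if "\<And>f. f \<in> C \<Longrightarrow> b \<le> f A" for b A
        using that False by (auto simp: u_def intro: cINF_greatest)
      have "admissible u"
        unfolding admissible_def
      proof (intro conjI ballI allI impI)
        have "(\<lambda>f. f {}) ` C = (\<lambda>f. 0) ` C"
          by (intro image_cong refl admissible_empty adm)
        then show "u {} = 0" using False by (simp add: u_def)
      next
        show "u A = 0" if "A \<notin> Fpow X" for A
          using adm False that by (simp add: u_def admissible_eq_0)
        show "\<delta> A \<le> u A" if "A \<in> Fpow X" for A
          using that adm by (intro le_u admissible_ge)
        show "u (A \<union> B) \<le> u A + u B" if AB: "A \<in> Fpow X" "B \<in> Fpow X" for A B
        proof -
          have "u (A \<union> B) \<le> f A + g B" if fg: "f \<in> C" "g \<in> C" for f g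
          proof -
            have "f (A \<union> B) \<le> f A + f B" "g (A \<union> B) \<le> g A + g B"
              using AB adm fg by (auto intro: admissible_Un)
            \<comment> \<open>Members of a chain are comparable, so one of the two is the smaller at
              both \<open>A\<close> and \<open>B\<close>; its own subadditivity gives the
              bound.\<close>
            moreover have "(f A \<le> g A \<and> f B \<le> g B) \<or> (g A \<le> f A \<and> g B \<le> f B)"
              using chain[OF fg] by (auto simp: le_fun_def)
            ultimately show ?thesis
              using u_le[OF fg(1), of "A \<union> B"] u_le[OF fg(2), of "A \<union> B"] by linarith
          qed
          then have "u (A \<union> B) - f A \<le> u B" if "f \<in> C" for f
            using that by (intro le_u) (simp add: diff_le_eq add.commute[of _ "f A"])
          then have "u (A \<union> B) - u B \<le> u A"
            by (intro le_u) (simp add: diff_le_eq add.commute)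
          then show ?thesis by simp
        qed
      qed
      moreover have "u \<le> f" if "f \<in> C" for f
        using u_le[OF that] by (simp add: le_fun_def)
      moreover have "u \<le> h"
        using False le_h \<open>\<And>f. f \<in> C \<Longrightarrow> u \<le> f\<close> by (meson all_not_in_conv order.trans)
      ultimately show ?thesis by blast
    qed
  qed
  then obtain m where m: "admissible m" "m \<le> h"
    and minimal: "\<And>f. admissible f \<Longrightarrow> f \<le> h \<Longrightarrow> f \<le> m \<Longrightarrow> f = m"
    by auto
  have "m \<in> tight_span"
    using m(2) by (intro minimal_admissible_in_tight_span m(1) minimal) (auto intro: order.trans)
  with m(2) show thesis by (rule that[rotated])
qed

text \<open>A point \<open>x\<close> yields the admissible function
  \<open>\<delta> ({x} \<union> A)\<close> of \<open>A\<close>, its image under the canonical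
  embedding into the tight span. For empty \<open>X\<close> the zero function serves.\<close>

lemma tight_span_nonempty: "tight_span \<noteq> {}"
proof (cases "X = {}")
  case True
  then have "Fpow X = {{}}" by (auto simp: Fpow_def)
  then have "(\<lambda>_. 0) \<in> tight_span"
    by (simp add: tight_span_def admissible_def)
  then show ?thesis by blast
next
  case False
  then obtain x where x: "{x} \<in> Fpow X" by (auto simp: Fpow_def)
  define h where "h A = (if A \<in> Fpow X then \<delta> ({x} \<union> A) else 0)" for A
  have "\<delta> A \<le> \<delta> ({x} \<union> A)" if "A \<in> Fpow X" for A
    using triangle[OF that x, of "{}"] eq_0_iff[OF x] by (simp add: insert_commute)
  moreover have "\<delta> ({x} \<union> (A \<union> B)) \<le> \<delta> ({x} \<union> A) + \<delta> ({x} \<union> B)" if "A \<in> Fpow X" "B \<in> Fpow X" for A B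
    using triangle[OF Un_in_Fpow[OF x that(1)] x that(2)] by (simp add: insert_commute)
  ultimately have "admissible h"
    using eq_0_iff[OF x] by (simp add: admissible_def h_def)
  then show ?thesis using tight_span_below_admissible by blast
qed

section \<open>The diversity on the tight span\<close>

text \<open>The triangle inequality through \<open>{x}\<close> splits
  \<open>\<delta> (A \<union> B)\<close> into a part charged to \<open>f\<close> and a part charged
  to \<open>g\<close>. The excess does not depend on \<open>A\<close>, which later makes suprema
  finite and distances bounded.\<close>

lemma tight_span_le_add:
  assumes f: "admissible f" and g: "g \<in> tight_span" and x: "x \<in> X" and A: "A \<in> Fpow X"
  shows "g A \<le> f A + (f {x} + g {x})"
proof (rule tight_span_le[OF g A])
  fix B assume B: "B \<in> Fpow X"
  have x': "{x} \<in> Fpow X" using x by (simp add: Fpow_def)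
  have "\<delta> (A \<union> B) \<le> \<delta> (A \<union> {x}) + \<delta> ({x} \<union> B)"
    using A B x' by (intro triangle) auto
  also have "\<dots> \<le> (f A + f {x}) + (g {x} + g B)"
    using A B x' f tight_span_admissible[OF g] by (intro add_mono delta_Un_le)
  finally show "\<delta> (A \<union> B) \<le> f A + (f {x} + g {x}) + g B" by simp
qed

lemma tight_span_bounded_diff:
  assumes f: "admissible f" and g: "g \<in> tight_span"
  shows "\<exists>M. \<forall>A\<in>Fpow X. g A \<le> f A + M"
proof (cases "X = {}")
  case True
  then show ?thesis using f tight_span_admissible[OF g] by (auto simp: Fpow_def admissible_empty)
next
  case False
  then show ?thesis using tight_span_le_add[OF f g] by blast
qed

text \<open>All chosen sets are first charged to one fixed \<open>g\<close> in \<open>F\<close>;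
  moving the charge for \<open>\<phi> f\<close> from \<open>g\<close> to \<open>f\<close> costs at
  most a constant \<open>M f\<close>.\<close>

lemma bdd_above_span_diversity:
  assumes "F \<in> Fpow tight_span"
  shows "bdd_above ((\<lambda>\<phi>. \<delta> (\<Union>f\<in>F. \<phi> f) - (\<Sum>f\<in>F. f (\<phi> f))) ` choices)"
proof (cases "F = {}")
  case True
  then show ?thesis by (auto intro: bdd_aboveI2)
next
  case False
  then obtain g where "g \<in> F" by blast
  with assms have g: "g \<in> tight_span" and fin: "finite F" and F: "F \<subseteq> tight_span"
    by (auto simp: Fpow_def)
  obtain M where M: "\<And>f A. f \<in> F \<Longrightarrow> A \<in> Fpow X \<Longrightarrow> g A \<le> f A + M f"
    using tight_span_bounded_diff[OF tight_span_admissible g] F by (metis subsetD)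
  show ?thesis
  proof (rule bdd_aboveI2)
    fix \<phi> :: "('a set \<Rightarrow> real) \<Rightarrow> 'a set" assume \<phi>: "\<phi> \<in> choices"
    have "\<delta> (\<Union>f\<in>F. \<phi> f) \<le> g (\<Union>f\<in>F. \<phi> f)"
      using choicesD[OF \<phi>] by (intro admissible_ge tight_span_admissible UN_in_Fpow g fin)
    also have "\<dots> \<le> (\<Sum>f\<in>F. g (\<phi> f))"
      using choicesD[OF \<phi>] by (intro admissible_UN tight_span_admissible g fin)
    also have "\<dots> \<le> (\<Sum>f\<in>F. f (\<phi> f) + M f)"
      by (intro sum_mono M choicesD[OF \<phi>])
    finally show "\<delta> (\<Union>f\<in>F. \<phi> f) - (\<Sum>f\<in>F. f (\<phi> f)) \<le> (\<Sum>f\<in>F. M f)"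
      by (simp add: sum.distrib)
  qed
qed

lemma le_span_diversity:
  assumes "F \<in> Fpow tight_span" "\<phi> \<in> choices"
  shows "\<delta> (\<Union>f\<in>F. \<phi> f) \<le> span_diversity F + (\<Sum>f\<in>F. f (\<phi> f))"
  using cSUP_upper[OF assms(2) bdd_above_span_diversity[OF assms(1)]]
  by (simp add: span_diversity_def)

lemma span_diversity_le:
  assumes "\<And>\<phi>. \<phi> \<in> choices \<Longrightarrow> \<delta> (\<Union>f\<in>F. \<phi> f) \<le> c + (\<Sum>f\<in>F. f (\<phi> f))"
  shows "span_diversity F \<le> c"
proof -
  have "(\<lambda>_. {}) \<in> (choices :: (('a set \<Rightarrow> real) \<Rightarrow> 'a set) set)" by (simp add: choices_def)
  then have "(choices :: (('a set \<Rightarrow> real) \<Rightarrow> 'a set) set) \<noteq> {}" by blast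
  then show ?thesis
    unfolding span_diversity_def using assms by (intro cSUP_least) (auto simp: algebra_simps)
qed

lemma span_diversity_nonneg:
  assumes "F \<in> Fpow tight_span"
  shows "0 \<le> span_diversity F"
proof -
  have "(\<Sum>f\<in>F. f {}) = 0"
    using assms by (intro sum.neutral) (auto simp: Fpow_def tight_span_admissible admissible_empty)
  then show ?thesis
    using le_span_diversity[OF assms, of "\<lambda>_. {}"] by (simp add: choices_def)
qed

lemma span_diversity_mono:
  assumes "F \<subseteq> G" and G: "G \<in> Fpow tight_span"
  shows "span_diversity F \<le> span_diversity G"
proof (rule span_diversity_le)
  fix \<phi> :: "('a set \<Rightarrow> real) \<Rightarrow> 'a set" assume \<phi>: "\<phi> \<in> choices"
  \<comment> \<open>Points outside \<open>F\<close> choose \<open>{}\<close>, which costs nothing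
    because \<open>f {} = 0\<close>.\<close>
  let ?\<psi> = "\<lambda>f. if f \<in> F then \<phi> f else {}"
  have "?\<psi> \<in> choices" using \<phi> by (simp add: choices_def)
  note le_span_diversity[OF G this]
  moreover have "(\<Union>f\<in>G. ?\<psi> f) = (\<Union>f\<in>F. \<phi> f)"
    using assms(1) by (auto split: if_splits)
  moreover have "(\<Sum>f\<in>G. f (?\<psi> f)) = (\<Sum>f\<in>F. f (\<phi> f))"
    using G assms(1)
    by (intro sum.mono_neutral_cong_right) (auto simp: Fpow_def tight_span_admissible admissible_empty)
  ultimately show "\<delta> (\<Union>f\<in>F. \<phi> f) \<le> span_diversity G + (\<Sum>f\<in>F. f (\<phi> f))" by simp
qed

text \<open>If \<open>g\<close> is already in \<open>F\<close>, the extra set \<open>B\<close> is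
  merged into \<open>\<phi> g\<close> and subadditivity of \<open>g\<close> pays for it; otherwise
  \<open>B\<close> becomes the choice at \<open>g\<close>. Treating both cases here avoids
  distinctness assumptions later.\<close>

lemma le_span_diversity_insert:
  assumes F: "F \<in> Fpow tight_span" and g: "g \<in> tight_span" and \<phi>: "\<phi> \<in> choices" and B: "B \<in> Fpow X"
  shows "\<delta> ((\<Union>f\<in>F. \<phi> f) \<union> B) \<le> span_diversity (insert g F) + (\<Sum>f\<in>F. f (\<phi> f)) + g B"
proof -
  have gF: "insert g F \<in> Fpow tight_span" and fin: "finite F" using F g by (auto simp: Fpow_def)
  show ?thesis
  proof (cases "g \<in> F")
    case True
    let ?\<psi> = "\<phi>(g := \<phi> g \<union> B)"
    have "?\<psi> \<in> choices" using \<phi> B by (simp add: choices_def)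
    from le_span_diversity[OF gF this]
    have "\<delta> (\<Union>f\<in>F. ?\<psi> f) \<le> span_diversity (insert g F) + (\<Sum>f\<in>F. f (?\<psi> f))"
      using True by (simp only: insert_absorb)
    moreover have "(\<Union>f\<in>F. ?\<psi> f) = (\<Union>f\<in>F. \<phi> f) \<union> B"
      using True by (auto split: if_splits)
    moreover have "(\<Sum>f\<in>F. f (?\<psi> f)) \<le> (\<Sum>f\<in>F. f (\<phi> f)) + g B"
      using admissible_Un[OF tight_span_admissible[OF g] choicesD[OF \<phi>] B, of g]
      by (simp add: sum.remove[OF fin True])
    ultimately show ?thesis by simp
  next
    case False
    let ?\<psi> = "\<phi>(g := B)"
    have "?\<psi> \<in> choices" using \<phi> B by (simp add: choices_def)
    note le_span_diversity[OF gF this]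
    moreover have "(\<Union>f\<in>insert g F. ?\<psi> f) = (\<Union>f\<in>F. \<phi> f) \<union> B"
      using False by (auto split: if_splits)
    moreover have "(\<Sum>f\<in>insert g F. f (?\<psi> f)) = (\<Sum>f\<in>F. f (\<phi> f)) + g B"
      using fin False by (auto simp: intro!: sum.cong)
    ultimately show ?thesis by simp
  qed
qed

lemma le_span_diversity_pair:
  assumes f: "f \<in> tight_span" and g: "g \<in> tight_span" and A: "A \<in> Fpow X" and B: "B \<in> Fpow X"
  shows "\<delta> (A \<union> B) \<le> span_diversity {f, g} + f A + g B"
  using le_span_diversity_insert[of "{f}" g "\<lambda>_. A" B] assms
  by (simp add: Fpow_def choices_def insert_commute)

lemma span_diversity_pair_le:
  assumes f: "f \<in> tight_span" and g: "g \<in> tight_span"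
    and le: "\<And>A B. A \<in> Fpow X \<Longrightarrow> B \<in> Fpow X \<Longrightarrow> \<delta> (A \<union> B) \<le> c + f A + g B"
  shows "span_diversity {f, g} \<le> c"
proof (rule span_diversity_le)
  fix \<phi> :: "('a set \<Rightarrow> real) \<Rightarrow> 'a set" assume \<phi>: "\<phi> \<in> choices"
  show "\<delta> (\<Union>h\<in>{f, g}. \<phi> h) \<le> c + (\<Sum>h\<in>{f, g}. h (\<phi> h))"
    \<comment> \<open>The instance with \<open>{}\<close> settles \<open>f = g\<close>, where only
      one set is chosen.\<close>
    using le[of "\<phi> f" "\<phi> g"] le[of "\<phi> f" "{}"] choicesD[OF \<phi>] admissible_empty[OF tight_span_admissible[OF g]]
    by (cases "f = g") (simp_all add: add.assoc)
qed

text \<open>The preceding bounds hold for every \<open>B\<close>, so extremality of \<open>g\<close>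
  turns them into a bound on a value of \<open>g\<close>. The triangle inequality rests on
  this.\<close>

lemma tight_span_le_span_diversity:
  assumes F: "F \<in> Fpow tight_span" and g: "g \<in> tight_span" and \<phi>: "\<phi> \<in> choices"
  shows "g (\<Union>f\<in>F. \<phi> f) \<le> span_diversity (insert g F) + (\<Sum>f\<in>F. f (\<phi> f))"
proof (rule tight_span_le[OF g])
  show "(\<Union>f\<in>F. \<phi> f) \<in> Fpow X" using F by (intro UN_in_Fpow choicesD[OF \<phi>]) (simp add: Fpow_def)
qed (rule le_span_diversity_insert[OF assms])

text \<open>For the triangle inequality, a point \<open>g\<close> of the middle set mediates:
  \<open>\<delta>\<close> of a chosen union is at most the sum of two values of \<open>g\<close>,
  one for each side, and each is bounded by \<open>tight_span_le_span_diversity\<close>.\<close>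

theorem diversity_tight_span: "diversity tight_span span_diversity"
proof
  fix F assume F: "F \<in> Fpow tight_span"
  then show ge0: "0 \<le> span_diversity F" by (rule span_diversity_nonneg)
  have fin: "finite F" using F by (simp add: Fpow_def)
  show "span_diversity F = 0 \<longleftrightarrow> card F \<le> 1"
  proof
    assume eq0: "span_diversity F = 0"
    have "f = g" if fg: "f \<in> F" "g \<in> F" for f g
    proof (rule tight_span_eqI)
      show fg': "f \<in> tight_span" "g \<in> tight_span" using F fg by (auto simp: Fpow_def)
      have "span_diversity {f, g} \<le> 0"
        using span_diversity_mono[OF _ F, of "{f, g}"] eq0 fg by simp
      then show "\<delta> (A \<union> B) \<le> f A + g B" if "A \<in> Fpow X" "B \<in> Fpow X" for A B
        using le_span_diversity_pair[OF fg' that] by simp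
    qed
    then show "card F \<le> 1" using card_le_Suc0_iff_eq[OF fin] by simp
  next
    assume "card F \<le> 1"
    then consider "F = {}" | f where "F = {f}"
      using fin by (metis card_le_Suc0_iff_eq One_nat_def all_not_in_conv is_singletonI' is_singleton_the_elem)
    then have "span_diversity F \<le> 0"
    proof cases
      case 1
      then show ?thesis by (intro span_diversity_le) simp
    next
      case 2
      then have "f \<in> tight_span" using F by (simp add: Fpow_def)
      then show ?thesis unfolding 2
        by (intro span_diversity_le) (simp add: choicesD admissible_ge tight_span_admissible)
    qed
    with ge0 show "span_diversity F = 0" by simp
  qed
next
  fix F G H assume F: "F \<in> Fpow tight_span" and G: "G \<in> Fpow tight_span"
    and H: "H \<in> Fpow tight_span" and "G \<noteq> {}"
  then obtain g where g: "g \<in> G" "g \<in> tight_span" by (auto simp: Fpow_def)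
  show "span_diversity (F \<union> H) \<le> span_diversity (F \<union> G) + span_diversity (G \<union> H)"
  proof (rule span_diversity_le)
    fix \<phi> :: "('a set \<Rightarrow> real) \<Rightarrow> 'a set" assume \<phi>: "\<phi> \<in> choices"
    \<comment> \<open>Points common to \<open>F\<close> and \<open>H\<close> go to the first part
      only, so their charge is counted once.\<close>
    have H': "H - F \<in> Fpow tight_span" using H by (auto simp: Fpow_def)
    have fin: "finite F" "finite H" using F H by (auto simp: Fpow_def)
    have "(\<Union>f\<in>F \<union> H. \<phi> f) = (\<Union>f\<in>F. \<phi> f) \<union> (\<Union>f\<in>H - F. \<phi> f)" by blast
    then have "\<delta> (\<Union>f\<in>F \<union> H. \<phi> f) \<le> g (\<Union>f\<in>F. \<phi> f) + g (\<Union>f\<in>H - F. \<phi> f)"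
      using fin by (simp only:) (intro delta_Un_le UN_in_Fpow choicesD[OF \<phi>] tight_span_admissible[OF g(2)]; simp)
    also have "g (\<Union>f\<in>F. \<phi> f) \<le> span_diversity (F \<union> G) + (\<Sum>f\<in>F. f (\<phi> f))"
      using tight_span_le_span_diversity[OF F g(2) \<phi>]
        span_diversity_mono[of "insert g F" "F \<union> G"] F G g by auto
    also have "g (\<Union>f\<in>H - F. \<phi> f) \<le> span_diversity (G \<union> H) + (\<Sum>f\<in>H - F. f (\<phi> f))"
    proof -
      have "span_diversity (insert g (H - F)) \<le> span_diversity (G \<union> H)"
        using G H g by (intro span_diversity_mono) auto
      then show ?thesis using tight_span_le_span_diversity[OF H' g(2) \<phi>] by simp
    qed
    also have "span_diversity (F \<union> G) + (\<Sum>f\<in>F. f (\<phi> f)) + (span_diversity (G \<union> H) + (\<Sum>f\<in>H - F. f (\<phi> f)))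
        = span_diversity (F \<union> G) + span_diversity (G \<union> H) + (\<Sum>f\<in>F \<union> H. f (\<phi> f))"
      using sum.union_disjoint[of F "H - F" "\<lambda>f. f (\<phi> f)"] fin by simp
    finally show "\<delta> (\<Union>f\<in>F \<union> H. \<phi> f)
        \<le> span_diversity (F \<union> G) + span_diversity (G \<union> H) + (\<Sum>f\<in>F \<union> H. f (\<phi> f))" by simp
  qed
qed

section \<open>Hyperconvexity of the tight span\<close>

text \<open>The condition on \<open>r\<close> is what makes a suitable function \<open>h\<close>
  built from \<open>r\<close> admissible; any point of the tight span below \<open>h\<close> is then
  a solution.\<close>

theorem hyperconvex_tight_span: "hyperconvex_diversity tight_span span_diversity"
proof (intro hyperconvex_diversity.intro hyperconvex_diversity_axioms.intro diversity_tight_span)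
  fix r :: "('a set \<Rightarrow> real) set \<Rightarrow> real"
  assume r0: "r {} = 0"
    and r: "\<And>\<A>. finite \<A> \<Longrightarrow> \<A> \<subseteq> Fpow tight_span \<Longrightarrow> span_diversity (\<Union>\<A>) \<le> (\<Sum>F\<in>\<A>. r F)"
  have r_ge: "span_diversity F \<le> r F" if "F \<in> Fpow tight_span" for F
    using r[of "{F}"] that by simp
  have r_nonneg: "0 \<le> r F" if "F \<in> Fpow tight_span" for F
    using r_ge[OF that] span_diversity_nonneg[OF that] by simp
  have Union: "\<Union>\<A> \<in> Fpow tight_span" if "finite \<A>" "\<A> \<subseteq> Fpow tight_span" for \<A>
    using that by (auto simp: Fpow_def)
  \<comment> \<open>The triangle inequality bounds \<open>z (\<Union>f\<in>F. \<phi> f)\<close> by \<open>r F + (\<Sum>f\<in>F. f (\<phi> f))\<close> for the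
    point \<open>z\<close> to be found; \<open>h\<close> below is the largest subadditive function obeying these bounds.\<close>
  define cost where "cost \<A> \<phi> = (\<Sum>F\<in>\<A>. r F) + (\<Sum>f\<in>\<Union>\<A>. f (\<phi> f))" for \<A> \<phi>
  define V where "V A = {cost \<A> \<phi> | \<A> \<phi>. finite \<A> \<and> \<A> \<subseteq> Fpow tight_span \<and> \<phi> \<in> choices
      \<and> (\<Union>f\<in>\<Union>\<A>. \<phi> f) = A}" for A
  define h where "h A = (if A \<in> Fpow X then Inf (V A) else 0)" for A
  \<comment> \<open>The condition on \<open>r\<close> for arbitrary finite families enters here, by
    bounding \<open>span_diversity (\<Union>\<A>)\<close>.\<close>
  have delta_le: "\<delta> A \<le> v" if vA: "v \<in> V A" for v A
  proof -
    obtain \<A> \<phi> where v: "v = cost \<A> \<phi>" and \<A>: "finite \<A>" "\<A> \<subseteq> Fpow tight_span"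
      and \<phi>: "\<phi> \<in> choices" and A: "(\<Union>f\<in>\<Union>\<A>. \<phi> f) = A"
      using vA unfolding V_def by blast
    show ?thesis
      using le_span_diversity[OF Union[OF \<A>] \<phi>] r[OF \<A>] unfolding v cost_def A by linarith
  qed
  have V_nonempty: "V A \<noteq> {}" if "A \<in> Fpow X" for A
  proof -
    obtain f where "f \<in> tight_span" using tight_span_nonempty by blast
    then have "cost {{f}} (\<lambda>_. A) \<in> V A"
      using that unfolding V_def by (intro CollectI exI[of _ "{{f}}"] exI[of _ "\<lambda>_. A"]) (simp add: Fpow_def choices_def)
    then show ?thesis by blast
  qed
  have bdd: "bdd_below (V A)" for A
    using delta_le by (rule bdd_belowI)
  have h_le: "h A \<le> v" if "A \<in> Fpow X" "v \<in> V A" for v A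
    using that bdd by (simp add: h_def cInf_lower)
  have le_h: "b \<le> h A" if "A \<in> Fpow X" "\<And>v. v \<in> V A \<Longrightarrow> b \<le> v" for b A
    using that V_nonempty by (simp add: h_def cInf_greatest)
  have V_Un: "\<exists>w\<in>V (A \<union> B). w \<le> u + v" if uv: "u \<in> V A" "v \<in> V B" for A B u v
  proof -
    obtain \<A> \<phi> where u: "u = cost \<A> \<phi>" and \<A>: "finite \<A>" "\<A> \<subseteq> Fpow tight_span"
      and \<phi>: "\<phi> \<in> choices" and A: "(\<Union>f\<in>\<Union>\<A>. \<phi> f) = A"
      using uv(1) unfolding V_def by blast
    obtain \<B> \<psi> where v: "v = cost \<B> \<psi>" and \<B>: "finite \<B>" "\<B> \<subseteq> Fpow tight_span"
      and \<psi>: "\<psi> \<in> choices" and B: "(\<Union>f\<in>\<Union>\<B>. \<psi> f) = B"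
      using uv(2) unfolding V_def by blast
    \<comment> \<open>Each choice is cut off outside its own family, so that the merged choice
      \<open>\<omega>\<close> covers exactly \<open>A \<union> B\<close>.\<close>
    define \<phi>' where "\<phi>' f = (if f \<in> \<Union>\<A> then \<phi> f else {})" for f
    define \<psi>' where "\<psi>' f = (if f \<in> \<Union>\<B> then \<psi> f else {})" for f
    define \<omega> where "\<omega> f = \<phi>' f \<union> \<psi>' f" for f
    have \<phi>'X: "\<phi>' f \<in> Fpow X" and \<psi>'X: "\<psi>' f \<in> Fpow X" for f
      using choicesD[OF \<phi>] choicesD[OF \<psi>] by (auto simp: \<phi>'_def \<psi>'_def)
    then have \<omega>: "\<omega> \<in> choices" by (simp add: choices_def \<omega>_def)
    have fin: "finite (\<Union>(\<A> \<union> \<B>))" and TS: "\<Union>(\<A> \<union> \<B>) \<subseteq> tight_span"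
      using Union[OF \<A>] Union[OF \<B>] by (auto simp: Fpow_def)
    have zero: "f {} = 0" if "f \<in> \<Union>(\<A> \<union> \<B>)" for f
      using that TS by (intro admissible_empty tight_span_admissible) blast
    have "(\<Sum>f\<in>\<Union>(\<A> \<union> \<B>). f (\<omega> f)) \<le> (\<Sum>f\<in>\<Union>(\<A> \<union> \<B>). f (\<phi>' f) + f (\<psi>' f))"
      unfolding \<omega>_def using TS
      by (intro sum_mono admissible_Un \<phi>'X \<psi>'X tight_span_admissible) blast
    also have "\<dots> = (\<Sum>f\<in>\<Union>(\<A> \<union> \<B>). f (\<phi>' f)) + (\<Sum>f\<in>\<Union>(\<A> \<union> \<B>). f (\<psi>' f))"
      by (rule sum.distrib)
    also have "(\<Sum>f\<in>\<Union>(\<A> \<union> \<B>). f (\<phi>' f)) = (\<Sum>f\<in>\<Union>\<A>. f (\<phi> f))"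
      using fin zero by (intro sum.mono_neutral_cong_right) (auto simp: \<phi>'_def)
    also have "(\<Sum>f\<in>\<Union>(\<A> \<union> \<B>). f (\<psi>' f)) = (\<Sum>f\<in>\<Union>\<B>. f (\<psi> f))"
      using fin zero by (intro sum.mono_neutral_cong_right) (auto simp: \<psi>'_def)
    finally have sum_\<omega>: "(\<Sum>f\<in>\<Union>(\<A> \<union> \<B>). f (\<omega> f)) \<le> (\<Sum>f\<in>\<Union>\<A>. f (\<phi> f)) + (\<Sum>f\<in>\<Union>\<B>. f (\<psi> f))" .
    \<comment> \<open>Sets in both families are counted once in the union of the families; as
      \<open>r\<close> is nonnegative on them, this only lowers the cost.\<close>
    have "0 \<le> (\<Sum>F\<in>\<A> \<inter> \<B>. r F)"
      using \<A> by (intro sum_nonneg r_nonneg) blast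
    then have "(\<Sum>F\<in>\<A> \<union> \<B>. r F) \<le> (\<Sum>F\<in>\<A>. r F) + (\<Sum>F\<in>\<B>. r F)"
      using sum.union_inter[OF \<A>(1) \<B>(1), of r] by linarith
    with sum_\<omega> have "cost (\<A> \<union> \<B>) \<omega> \<le> u + v"
      unfolding u v cost_def by linarith
    moreover have "(\<Union>f\<in>F \<union> G. (if f \<in> F then \<phi> f else {}) \<union> (if f \<in> G then \<psi> f else {}))
        = (\<Union>f\<in>F. \<phi> f) \<union> (\<Union>f\<in>G. \<psi> f)" for F G
      by (auto split: if_splits)
    then have "(\<Union>f\<in>\<Union>(\<A> \<union> \<B>). \<omega> f) = A \<union> B"
      unfolding A[symmetric] B[symmetric] \<omega>_def \<phi>'_def \<psi>'_def Union_Un_distrib .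
    then have "cost (\<A> \<union> \<B>) \<omega> \<in> V (A \<union> B)"
      using \<A> \<B> \<omega> unfolding V_def by blast
    ultimately show ?thesis by blast
  qed
  have "admissible h"
    unfolding admissible_def
  proof (intro conjI ballI allI impI)
    have "cost {} (\<lambda>_. {}) \<in> V {}"
      unfolding V_def by (intro CollectI exI[of _ "{}"] exI[of _ "\<lambda>_. {}"]) (simp add: choices_def)
    then have "h {} \<le> 0" using h_le[of "{}" 0] by (simp add: cost_def)
    moreover have "0 \<le> h {}" using delta_le by (intro le_h) force+
    ultimately show "h {} = 0" by simp
  next
    show "\<delta> A \<le> h A" if "A \<in> Fpow X" for A
      using that delta_le by (rule le_h)
  next
    fix A B assume AB: "A \<in> Fpow X" "B \<in> Fpow X"
    have "h (A \<union> B) - u \<le> v" if uv: "u \<in> V A" "v \<in> V B" for u v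
    proof -
      obtain w where "w \<in> V (A \<union> B)" "w \<le> u + v" using V_Un[OF uv] by blast
      then show ?thesis using h_le[of "A \<union> B" w] AB by simp
    qed
    then have "h (A \<union> B) - u \<le> h B" if "u \<in> V A" for u
      using that AB by (intro le_h) auto
    then have "h (A \<union> B) - h B \<le> h A"
      using AB by (intro le_h) (auto simp: algebra_simps)
    then show "h (A \<union> B) \<le> h A + h B" by simp
  qed (simp add: h_def)
  then obtain z where z: "z \<in> tight_span" "z \<le> h"
    by (rule tight_span_below_admissible)
  have "span_diversity ({z} \<union> F) \<le> r F" if F: "F \<in> Fpow tight_span" for F
  proof (cases "z \<in> F")
    case True
    then show ?thesis using r_ge[OF F] by (simp add: insert_absorb)
  next
    case False
    have fin: "finite F" using F by (simp add: Fpow_def)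
    show ?thesis
    proof (rule span_diversity_le)
      fix \<phi> :: "('a set \<Rightarrow> real) \<Rightarrow> 'a set" assume \<phi>: "\<phi> \<in> choices"
      let ?A = "\<Union>f\<in>F. \<phi> f"
      have A: "?A \<in> Fpow X" by (intro UN_in_Fpow fin choicesD[OF \<phi>])
      have "cost {F} \<phi> \<in> V ?A"
        using F \<phi> unfolding V_def by (intro CollectI exI[of _ "{F}"] exI[of _ \<phi>]) simp
      then have "h ?A \<le> cost {F} \<phi>" by (rule h_le[OF A])
      moreover have "z ?A \<le> h ?A" using z(2) by (simp add: le_fun_def)
      moreover have "\<delta> (\<phi> z \<union> ?A) \<le> z (\<phi> z) + z ?A"
        using A by (intro delta_Un_le tight_span_admissible z choicesD[OF \<phi>])
      ultimately show "\<delta> (\<Union>f\<in>{z} \<union> F. \<phi> f) \<le> r F + (\<Sum>f\<in>{z} \<union> F. f (\<phi> f))"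
        using fin False by (simp add: cost_def)
    qed
  qed
  with z(1) show "\<exists>z\<in>tight_span. \<forall>F\<in>Fpow tight_span. span_diversity ({z} \<union> F) \<le> r F" by blast
qed

section \<open>Symmetries acting on the tight span\<close>

lemma image_in_Fpow_iff:
  assumes "bij \<sigma>" "\<sigma> ` X = X"
  shows "\<sigma> ` A \<in> Fpow X \<longleftrightarrow> A \<in> Fpow X"
  using assms inj_image_subset_iff[of \<sigma> A X]
  by (auto simp: Fpow_def bij_def finite_image_iff inj_on_subset)

text \<open>Every test set \<open>B\<close> is the image of \<open>inv \<sigma>\<close>
  B\<open>, so testing\<close>f\<open>at\<close>\<sigma> \<open>A\<close> amounts to testing the
  pullback at \<open>A\<close>.\<close>

lemma pullback_in_tight_span:
  assumes \<sigma>: "bij \<sigma>" "\<sigma> ` X = X" and \<delta>: "\<And>A. A \<in> Fpow X \<Longrightarrow> \<delta> (\<sigma> ` A) = \<delta> A"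
    and f: "f \<in> tight_span"
  shows "(\<lambda>A. f (\<sigma> ` A)) \<in> tight_span"
proof -
  note iff = image_in_Fpow_iff[OF \<sigma>]
  have adm: "admissible f" using f by (rule tight_span_admissible)
  have "admissible (\<lambda>A. f (\<sigma> ` A))"
    unfolding admissible_def
  proof (intro conjI ballI allI impI)
    show "\<delta> A \<le> f (\<sigma> ` A)" if "A \<in> Fpow X" for A
      using admissible_ge[OF adm, of "\<sigma> ` A"] that \<delta> iff by simp
  qed (use adm iff in \<open>simp_all add: image_Un admissible_empty admissible_Un admissible_eq_0\<close>)
  moreover have "f (\<sigma> ` A) \<le> c"
    if A: "A \<in> Fpow X" and c: "\<And>B. B \<in> Fpow X \<Longrightarrow> \<delta> (A \<union> B) \<le> c + f (\<sigma> ` B)" for A c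
  proof (rule tight_span_le[OF f])
    show "\<sigma> ` A \<in> Fpow X" using A iff by simp
    fix B assume "B \<in> Fpow X"
    moreover have B: "\<sigma> ` (inv \<sigma> ` B) = B"
      using \<sigma> by (simp add: image_f_inv_f bij_is_surj)
    ultimately have "inv \<sigma> ` B \<in> Fpow X" using iff[of "inv \<sigma> ` B"] by simp
    then show "\<delta> (\<sigma> ` A \<union> B) \<le> c + f B"
      using c[of "inv \<sigma> ` B"] \<delta>[of "A \<union> inv \<sigma> ` B"] A B by (simp add: image_Un)
  qed
  ultimately show ?thesis by (simp add: tight_span_def)
qed

text \<open>The images of \<open>A\<close> and \<open>B\<close> under \<open>\<sigma>\<close> are
  among the pairs of sets that bound \<open>span_diversity {f, g}\<close> from below.\<close>

lemma span_diversity_pullback_le: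
  assumes \<sigma>: "bij \<sigma>" "\<sigma> ` X = X" and \<delta>: "\<And>A. A \<in> Fpow X \<Longrightarrow> \<delta> (\<sigma> ` A) = \<delta> A"
    and f: "f \<in> tight_span" and g: "g \<in> tight_span"
  shows "span_diversity {\<lambda>A. f (\<sigma> ` A), \<lambda>A. g (\<sigma> ` A)} \<le> span_diversity {f, g}"
proof (intro span_diversity_pair_le pullback_in_tight_span[OF \<sigma> \<delta>] f g)
  fix A B assume AB: "A \<in> Fpow X" "B \<in> Fpow X"
  then show "\<delta> (A \<union> B) \<le> span_diversity {f, g} + f (\<sigma> ` A) + g (\<sigma> ` B)"
    using le_span_diversity_pair[OF f g, of "\<sigma> ` A" "\<sigma> ` B"] \<delta>[of "A \<union> B"]
    by (simp add: image_in_Fpow_iff[OF \<sigma>] image_Un)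
qed

text \<open>First \<open>\<delta> (A \<union> B)\<close> is charged to \<open>g\<close> alone; then
  \<open>tight_span_le_add\<close> trades \<open>g A\<close> for \<open>f A\<close>. A bound on the
  values at one singleton thus bounds all distances.\<close>

lemma span_diversity_pair_bound:
  assumes f: "f \<in> tight_span" and g: "g \<in> tight_span" and x: "x \<in> X"
  shows "span_diversity {f, g} \<le> f {x} + g {x}"
proof (rule span_diversity_pair_le[OF f g])
  fix A B assume AB: "A \<in> Fpow X" "B \<in> Fpow X"
  show "\<delta> (A \<union> B) \<le> f {x} + g {x} + f A + g B"
    using delta_Un_le[OF tight_span_admissible[OF g] AB]
      tight_span_le_add[OF tight_span_admissible[OF f] g x AB(1)] by simp
qed

end

section \<open>The diversity of cardinalities\<close>

text \<open>Subtraction is truncated before the conversion to reals, so \<open>{}\<close> gets the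
  value 0 and not -1.\<close>

definition card_diversity :: "'a set \<Rightarrow> real" where
  "card_diversity A = real (card A - 1)"

text \<open>Inclusion-exclusion for \<open>A \<union> B\<close> and \<open>B \<union> C\<close>,
  whose intersection contains \<open>B\<close>; that \<open>B\<close> has at least one element
  absorbs the second -1 on the right.\<close>

lemma diversity_card: "diversity UNIV card_diversity"
proof
  fix A B C :: "'a set"
  assume "A \<in> Fpow UNIV" "B \<in> Fpow UNIV" "C \<in> Fpow UNIV" and B: "B \<noteq> {}"
  then have fin: "finite A" "finite B" "finite C" by (auto simp: Fpow_def)
  have "card (A \<union> C) \<le> card ((A \<union> B) \<union> (B \<union> C))"
    using fin by (intro card_mono) auto
  moreover have "card B \<le> card ((A \<union> B) \<inter> (B \<union> C))"
    using fin by (intro card_mono) auto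
  moreover have "card (A \<union> B) + card (B \<union> C)
      = card ((A \<union> B) \<union> (B \<union> C)) + card ((A \<union> B) \<inter> (B \<union> C))"
    using fin by (intro card_Un_Int) auto
  moreover have "0 < card B" using fin B by (simp add: card_gt_0_iff)
  ultimately have "card (A \<union> C) - 1 \<le> (card (A \<union> B) - 1) + (card (B \<union> C) - 1)"
    by linarith
  then show "card_diversity (A \<union> C) \<le> card_diversity (A \<union> B) + card_diversity (B \<union> C)"
    unfolding card_diversity_def by linarith
qed (auto simp: card_diversity_def)

interpretation card: diversity UNIV card_diversity
  by (rule diversity_card)

text \<open>Joining \<open>A\<close> to a nonempty \<open>B\<close> raises the diversity by at most
  \<open>card A\<close>, so \<open>card A\<close> passes the extremality test. Truncation makes
  \<open>B = {}\<close> a separate case.\<close>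

lemma card_tight_span_le:
  assumes f: "f \<in> card.tight_span" and A: "finite A"
  shows "f A \<le> real (card A)"
proof (rule card.tight_span_le[OF f])
  fix B :: "'a set" assume B: "B \<in> Fpow UNIV"
  have "card_diversity (A \<union> B) \<le> real (card A) + card_diversity B" if "B \<noteq> {}"
    using card_Un_le[of A B] that B by (cases "card B") (auto simp: Fpow_def card_diversity_def)
  moreover have "card_diversity B \<le> f B"
    using f B by (intro card.admissible_ge card.tight_span_admissible)
  moreover have "card_diversity A \<le> real (card A)" by (simp add: card_diversity_def)
  moreover have "f {} = 0" using f by (intro card.admissible_empty card.tight_span_admissible)
  ultimately show "card_diversity (A \<union> B) \<le> real (card A) + f B"
    by (cases "B = {}") auto
qed (use A in \<open>simp add: Fpow_def\<close>)

section \<open>Absence of translation-invariant points\<close>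

text \<open>The deficit \<open>card A - f A\<close> at least doubles when \<open>A\<close> is joined with a disjoint translate.\<close>

lemma no_shift_invariant_in_tight_span:
  fixes f :: "int set \<Rightarrow> real"
  assumes f: "f \<in> card.tight_span" and inv: "\<And>A. f ((+) 1 ` A) = f A"
  shows False
proof -
  have adm: "card.admissible f" using f by (rule card.tight_span_admissible)
  have translate: "f ((+) (int k) ` A) = f A" for k A
  proof (induction k)
    case 0
    then show ?case by simp
  next
    case (Suc k)
    have "(+) (int (Suc k)) ` A = (+) 1 ` (+) (int k) ` A" by (simp add: image_image add.assoc)
    then show ?case using Suc inv by simp
  qed
  have deficit: "2 ^ n * (real (card A) - f A) \<le> 1" if "finite A" for n A
    using that
  proof (induction n arbitrary: A)
    case 0
    then have "card_diversity A \<le> f A" by (intro card.admissible_ge[OF adm]) (simp add: Fpow_def)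
    then show ?case by (simp add: card_diversity_def)
  next
    case (Suc n)
    have "finite ((\<lambda>x. nat \<bar>x\<bar>) ` A)" using Suc.prems by simp
    then obtain m where m: "\<And>x. x \<in> A \<Longrightarrow> nat \<bar>x\<bar> < m"
      by (auto simp: finite_nat_set_iff_bounded)
    \<comment> \<open>All elements of \<open>A\<close> have absolute value below \<open>m\<close>,
      so a shift by \<open>2 * m\<close> moves \<open>A\<close> off itself.\<close>
    define B where "B = (+) (int (2 * m)) ` A"
    have B: "finite B" "card B = card A" "f B = f A"
      using Suc.prems translate by (simp_all add: B_def card_image del: of_nat_mult)
    have "x \<noteq> int (2 * m) + y" if "x \<in> A" "y \<in> A" for x y
      using m[OF that(1)] m[OF that(2)] by linarith
    then have "A \<inter> B = {}" by (auto simp: B_def)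
    then have "card (A \<union> B) = 2 * card A"
      using Suc.prems B by (simp add: card_Un_disjoint)
    moreover have "f (A \<union> B) \<le> 2 * f A"
      using card.admissible_Un[OF adm, of A B] Suc.prems B by (simp add: Fpow_def)
    ultimately have "2 ^ n * (2 * (real (card A) - f A)) \<le> 2 ^ n * (real (card (A \<union> B)) - f (A \<union> B))"
      by (intro mult_left_mono) auto
    also have "\<dots> \<le> 1" using Suc.IH[of "A \<union> B"] Suc.prems B by simp
    finally show ?case by (simp add: algebra_simps)
  qed
  \<comment> \<open>A positive deficit would exceed 1 after enough doublings.\<close>
  have card_le: "real (card A) \<le> f A" if A: "finite A" for A
  proof (rule ccontr)
    assume "\<not> real (card A) \<le> f A"
    then have pos: "0 < real (card A) - f A" by simp
    obtain n where "1 / (real (card A) - f A) < 2 ^ n"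
      using real_arch_pow[of 2] by auto
    then show False using deficit[OF A, of n] pos by (simp add: divide_less_eq)
  qed
  \<comment> \<open>Since \<open>f\<close> dominates the cardinality, even the constant 0 passes the
    extremality test at \<open>{0}\<close>, whereas \<open>f {0}\<close> is at least 1.\<close>
  have "f {0} \<le> 0"
  proof (rule card.tight_span_le[OF f])
    fix B :: "int set" assume B: "B \<in> Fpow UNIV"
    then have "card_diversity ({0} \<union> B) \<le> real (card B)"
      using card_Un_le[of "{0}" B] by (simp add: card_diversity_def)
    also have "\<dots> \<le> f B" using B by (intro card_le) (simp add: Fpow_def)
    finally show "card_diversity ({0} \<union> B) \<le> 0 + f B" by simp
  qed (simp add: Fpow_def)
  then show False using card_le[of "{0}"] by simp
qed

theorem theorem3p11:
  shows "\<exists>(X :: (int set \<Rightarrow> real) set) \<delta>.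
           hyperconvex_diversity X \<delta>
         \<and> Metric_space.mbounded X (induced_metric X \<delta>) X
         \<and> (\<exists>T. nonexpansive_selfmap X (induced_metric X \<delta>) T \<and> (\<forall>x\<in>X. T x \<noteq> x))
         \<and> \<not> fixed_point_property X (induced_metric X \<delta>)"
proof (intro exI conjI)
  let ?X = "card.tight_span :: (int set \<Rightarrow> real) set"
  let ?d = "induced_metric ?X card.span_diversity"
  let ?T = "\<lambda>f A. f ((+) 1 ` A) :: real"
  interpret S: diversity ?X card.span_diversity by (rule card.diversity_tight_span)
  interpret M: Metric_space ?X ?d by (rule S.Metric_space_induced_metric)
  have \<sigma>: "bij ((+) (1 :: int))" "(+) (1 :: int) ` UNIV = UNIV"
    by (auto simp: bij_plus_right)
  have \<delta>: "card_diversity ((+) 1 ` A) = card_diversity A" for A :: "int set"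
    by (simp add: card_image card_diversity_def)
  show "hyperconvex_diversity ?X card.span_diversity" by (rule card.hyperconvex_tight_span)
  \<comment> \<open>Both \<open>f {0}\<close> and \<open>g {0}\<close> are at most
    \<open>card {0} = 1\<close>.\<close>
  have "?d f g \<le> 2" if "f \<in> ?X" "g \<in> ?X" for f g
    using card.span_diversity_pair_bound[OF that, of 0] that
      card_tight_span_le[of f "{0}"] card_tight_span_le[of g "{0}"]
    by (simp add: induced_metric_def)
  then show "M.mbounded ?X" unfolding M.mbounded_alt by blast
  show T: "nonexpansive_selfmap ?X ?d ?T"
    using card.pullback_in_tight_span[OF \<sigma> \<delta>] card.span_diversity_pullback_le[OF \<sigma> \<delta>]
    by (simp add: nonexpansive_selfmap_def induced_metric_def)
  show no_fix: "\<forall>f\<in>?X. ?T f \<noteq> f"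
    using no_shift_invariant_in_tight_span by (metis (no_types))
  show "\<not> fixed_point_property ?X ?d"
    using T no_fix by (auto simp: fixed_point_property_def)
qed

end
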